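(* Let $u\in\operatorname{dom}s$. The following conclusions hold. (a) $u\in C$ if and only if $\mathcal E^u\subset\mathcal E_\beta$ for some $\beta\in\mathbb R^\sigma$. (b) $u\notin C$ if and only if $\mathcal E^u\cap\mathcal E_\beta=\emptyset$ for all $\beta\in\mathbb R^\sigma$.
   Context: Setting. For each $n\in\mathbb N$, $(\Omega_n,\mathcal F_n,P_n)$ is a probability space; $\sigma\ge1$ is an integer; $H_{n,1},\dots,H_{n,\sigma}:\Omega_n\to\mathbb R$ are bounded measurable functions; $a_n>0$ with $a_n\to\infty$. $\mathcal X$ is a Polish space, $Y_n:\Omega_n\to\mathcal X$ are random variables, and $\tilde H_1,\dots,\tilde H_\sigma:\mathcal X\to\mathbb R$ are bounded continuous functions such that $\lim_{n\to\infty}\sup_{\omega\in\Omega_n}|H_{n,i}(\omega)-\tilde H_i(Y_n(\omega))|=0$ for each $i$; $\tilde H:=(\tilde H_1,\dots,\tilde H_\sigma)$. With respect to $P_n$, $Y_n$ satisfies the large deviation principle on $\mathcal X$ with scaling constants $a_n$ and rate function $I:\mathcal X\to[0,\infty]$, where rate functions have compact level sets $\{I\le M\}$, $0\le M<\infty$ (in particular $\inf_{\mathcal X}I=0$). $\langle\cdot,\cdot\rangle$ is the Euclidean inner product. Definitions. Microcanonical entropy: $s(u):=-\inf\{I(x):x\in\mathcal X,\ \tilde H(x)=u\}\in[-\infty,0]$ for $u\in\mathbb R^\sigma$ (with $\inf\emptyset=\infty$); $\operatorname{dom}s:=\{u: s(u)>-\infty\}$. Canonical equilibrium macrostates, for $\beta\in\mathbb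 R^\sigma$: $\mathcal E_\beta:=\{x\in\mathcal X: I(x)+\langle\beta,\tilde H(x)\rangle=\inf_{y\in\mathcal X}\{I(y)+\langle\beta,\tilde H(y)\rangle\}\}$. Microcanonical equilibrium macrostates: $\mathcal E^u:=\{x\in\mathcal X:\tilde H(x)=u,\ I(x)=-s(u)\}$ for $u\in\operatorname{dom}s$, and $\mathcal E^u:=\emptyset$ for $u\notin\operatorname{dom}s$. $$C:=\{u\in\mathbb R^\sigma:\ \exists\beta\in\mathbb R^\sigma\text{ such that }s(w)\le s(u)+\langle\beta,w-u\rangle\text{ for all }w\in\mathbb R^\sigma\}.$$ *)

theory Defs
  imports "HOL-Probability.Probability"
begin

text \<open>
  Logarithm on \<open>[0, \<infinity>)\<close> with the convention \<open>log 0 = -\<infinity>\<close>; the library's \<open>ln 0 = 0\<close> would be wrong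
  for events of probability zero.
\<close>

definition log_prob :: "real \<Rightarrow> ereal"
  where "log_prob p = (if p = 0 then -\<infinity> else ereal (ln p))"

definition rate_function :: "('x::topological_space \<Rightarrow> ereal) \<Rightarrow> bool"
  where "rate_function I \<longleftrightarrow>
    (\<forall>x. 0 \<le> I x) \<and> (\<forall>M::real. 0 \<le> M \<longrightarrow> compact {x. I x \<le> ereal M})"

definition large_deviation_principle ::
    "(nat \<Rightarrow> 'w measure) \<Rightarrow> (nat \<Rightarrow> 'w \<Rightarrow> 'x::topological_space) \<Rightarrow> (nat \<Rightarrow> real) \<Rightarrow> ('x \<Rightarrow> ereal) \<Rightarrow> bool"
  where "large_deviation_principle P Y a I \<longleftrightarrow>
    rate_function I \<and>
    (\<forall>F. closed F \<longrightarrow>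
      limsup (\<lambda>n. ereal (1 / a n) * log_prob (measure (P n) (Y n -` F \<inter> space (P n))))
        \<le> - (INF x\<in>F. I x)) \<and>
    (\<forall>G. open G \<longrightarrow>
      - (INF x\<in>G. I x)
        \<le> liminf (\<lambda>n. ereal (1 / a n) * log_prob (measure (P n) (Y n -` G \<inter> space (P n)))))"

definition microcanonical_entropy :: "('x \<Rightarrow> ereal) \<Rightarrow> ('x \<Rightarrow> real ^ 'n) \<Rightarrow> real ^ 'n \<Rightarrow> ereal"
  where "microcanonical_entropy I Ht u = - (INF x\<in>{x. Ht x = u}. I x)"

definition entropy_dom :: "('x \<Rightarrow> ereal) \<Rightarrow> ('x \<Rightarrow> real ^ 'n) \<Rightarrow> (real ^ 'n) set"
  where "entropy_dom I Ht = {u. microcanonical_entropy I Ht u > -\<infinity>}"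

definition canonical_macrostates :: "('x \<Rightarrow> ereal) \<Rightarrow> ('x \<Rightarrow> real ^ 'n) \<Rightarrow> real ^ 'n \<Rightarrow> 'x set"
  where "canonical_macrostates I Ht \<beta> =
    {x. I x + ereal (\<beta> \<bullet> Ht x) = (INF y. I y + ereal (\<beta> \<bullet> Ht y))}"

definition microcanonical_macrostates :: "('x \<Rightarrow> ereal) \<Rightarrow> ('x \<Rightarrow> real ^ 'n) \<Rightarrow> real ^ 'n \<Rightarrow> 'x set"
  where "microcanonical_macrostates I Ht u =
    (if u \<in> entropy_dom I Ht
     then {x. Ht x = u \<and> I x = - microcanonical_entropy I Ht u}
     else {})"

definition entropy_support_set :: "('x \<Rightarrow> ereal) \<Rightarrow> ('x \<Rightarrow> real ^ 'n) \<Rightarrow> (real ^ 'n) set"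
  where "entropy_support_set I Ht =
    {u. \<exists>\<beta>. \<forall>w. microcanonical_entropy I Ht w
                 \<le> microcanonical_entropy I Ht u + ereal (\<beta> \<bullet> (w - u))}"

end

theory Submission
  imports Defs
begin

text \<open>
  Fix \<open>u\<close> in the domain of the entropy. Because the rate function has compact level sets and the
  constraint set \<open>{x. Ht x = u}\<close> is closed, the infimum defining the entropy at \<open>u\<close> is attained, so
  there is at least one microcanonical macrostate
  (\<open>rate_function_attains_INF_on_closed\<close>, \<open>microcanonical_macrostates_nonempty\<close>).
  This is the topological half of the argument.

  The other half is algebraic. Minimising \<open>I y + \<beta> \<bullet> Ht y\<close> over all \<open>y\<close> can be done in two
  stages, first over the level set \<open>Ht y = w\<close> and then over \<open>w\<close>; the first stage produces
  \<open>\<beta> \<bullet> w\<close> minus the entropy at \<open>w\<close>. A microcanonical macrostate at \<open>u\<close> already solves the first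
  stage at \<open>w = u\<close>, so it is canonical for \<open>\<beta>\<close> exactly when \<open>w = u\<close> solves the second stage, and that
  says that \<open>\<beta>\<close> is a supergradient of the entropy at \<open>u\<close>
  (\<open>microcanonical_macrostate_canonical_iff\<close>).

  The criterion mentions \<open>u\<close> and \<open>\<beta>\<close> but not the particular macrostate. For each \<open>\<beta>\<close>, therefore,
  either all microcanonical macrostates at \<open>u\<close> are canonical or none is. As there is at least one,
  inclusion for some \<open>\<beta>\<close>, nonempty intersection for some \<open>\<beta>\<close> and membership of \<open>u\<close> in the support
  set are the same condition, which is both parts of the theorem.
\<close>

text \<open>
  A minimiser is a point of \<open>F\<close> common to all level sets at heights strictly above the infimum.
  These are compact and nested and each meets \<open>F\<close>, so such a point exists by the finite
  intersection property.
\<close>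

lemma rate_function_attains_INF_on_closed:
  fixes I :: "'x::t2_space \<Rightarrow> ereal"
  assumes "rate_function I" and "closed F" and "F \<noteq> {}"
  shows "\<exists>x\<in>F. I x = (INF x\<in>F. I x)"
proof (cases "(INF x\<in>F. I x) = \<infinity>")
  case True
  then show ?thesis
    using \<open>F \<noteq> {}\<close> by (metis INF_lower all_not_in_conv ereal_infty_less_eq(1))
next
  case False
  have nonneg: "0 \<le> I x" and comp: "0 \<le> M \<Longrightarrow> compact {x. I x \<le> ereal M}" for x M
    using assms(1) by (auto simp: rate_function_def)
  have "0 \<le> (INF x\<in>F. I x)"
    by (rule INF_greatest) (rule nonneg)
  with False obtain m where m: "(INF x\<in>F. I x) = ereal m" and "0 \<le> m"
    by (cases "INF x\<in>F. I x") auto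
  define L where "L e = {x. I x \<le> ereal (m + e)}" for e
  have L_compact: "compact (L e)" if "e > 0" for e
    unfolding L_def using that \<open>0 \<le> m\<close> by (intro comp) simp
  have L_mono: "L d \<subseteq> L e" if "d \<le> e" for d e
    unfolding L_def using that by (auto elim: order_trans)
  have L_meets: "F \<inter> L e \<noteq> {}" if "e > 0" for e
  proof -
    have "(INF x\<in>F. I x) < ereal (m + e)"
      using m that by simp
    then obtain x where "x \<in> F" "I x < ereal (m + e)"
      by (auto simp: INF_less_iff)
    then show ?thesis
      by (auto simp: L_def)
  qed
  have "(L 1 \<inter> F) \<inter> (\<Inter>e\<in>{0<..}. L e) \<noteq> {}"
  proof (rule compact_imp_fip_image)
    show "compact (L 1 \<inter> F)"
      using L_compact \<open>closed F\<close> by (intro compact_Int_closed) auto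
    show "closed (L e)" if "e \<in> {0<..}" for e
      using that L_compact by (auto intro: compact_imp_closed)
    fix E :: "real set" assume E: "finite E" "E \<subseteq> {0<..}"
    define d where "d = Min (insert 1 E)"
    have "d > 0" and "\<And>e. e \<in> insert 1 E \<Longrightarrow> d \<le> e"
      using E by (auto simp: d_def)
    then have "L d \<subseteq> L 1 \<inter> (\<Inter>e\<in>E. L e)"
      using L_mono by blast
    with L_meets[OF \<open>d > 0\<close>] show "(L 1 \<inter> F) \<inter> (\<Inter>e\<in>E. L e) \<noteq> {}"
      by blast
  qed
  then obtain x where "x \<in> F" and x: "\<And>e. e > 0 \<Longrightarrow> I x \<le> ereal m + ereal e"
    by (auto simp: L_def)
  have "I x \<le> ereal m"
    by (rule ereal_le_epsilon2) (use x in blast)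
  moreover have "(INF x\<in>F. I x) \<le> I x"
    using \<open>x \<in> F\<close> by (rule INF_lower)
  ultimately show ?thesis
    using m \<open>x \<in> F\<close> by (metis antisym)
qed

lemma microcanonical_macrostates_nonempty:
  fixes I :: "'x::t2_space \<Rightarrow> ereal" and Ht :: "'x \<Rightarrow> real ^ 'n"
  assumes "rate_function I" and "continuous_on UNIV Ht" and "u \<in> entropy_dom I Ht"
  shows "microcanonical_macrostates I Ht u \<noteq> {}"
proof -
  have "closed {x. Ht x = u}"
    using assms(2) by (intro closed_Collect_eq) auto
  moreover have "{x. Ht x = u} \<noteq> {}"
    \<comment> \<open>otherwise the infimum over the empty set would make the entropy \<open>-\<infinity>\<close>\<close>
  proof
    assume "{x. Ht x = u} = {}"
    then have "(INF x\<in>{x. Ht x = u}. I x) = \<infinity>"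
      by (metis Inf_empty image_empty top_ereal_def)
    with assms(3) show False
      by (simp add: entropy_dom_def microcanonical_entropy_def)
  qed
  ultimately obtain x where "Ht x = u" "I x = (INF x\<in>{x. Ht x = u}. I x)"
    using rate_function_attains_INF_on_closed[OF assms(1)] by blast
  then show ?thesis
    using assms(3) by (auto simp: microcanonical_macrostates_def microcanonical_entropy_def)
qed

lemma canonical_macrostates_iff:
  "x \<in> canonical_macrostates I Ht \<beta> \<longleftrightarrow>
     (\<forall>y. I x + ereal (\<beta> \<bullet> Ht x) \<le> I y + ereal (\<beta> \<bullet> Ht y))"
proof -
  let ?f = "\<lambda>y. I y + ereal (\<beta> \<bullet> Ht y)"
  have "?f x = (INF y. ?f y) \<longleftrightarrow> ?f x \<le> (INF y. ?f y)"
    using INF_lower[of x UNIV ?f] by (auto intro: antisym)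
  then show ?thesis
    by (simp add: canonical_macrostates_def le_INF_iff)
qed

lemma microcanonical_entropy_le_iff:
  "microcanonical_entropy I Ht w \<le> c \<longleftrightarrow> (\<forall>y. Ht y = w \<longrightarrow> - c \<le> I y)"
  unfolding microcanonical_entropy_def
  by (subst ereal_uminus_le_reorder) (auto simp: le_INF_iff)

text \<open>
  By the previous two lemmas both sides are families of inequalities indexed by the points \<open>y\<close>, the
  right-hand family being grouped according to the value \<open>w = Ht y\<close>. Since the entropy at \<open>u\<close> is a
  finite number, the two inequalities belonging to a given \<open>y\<close> are rearrangements of each other,
  even where \<open>I y = \<infinity>\<close>.
\<close>

lemma microcanonical_macrostate_canonical_iff:
  fixes I :: "'x \<Rightarrow> ereal" and Ht :: "'x \<Rightarrow> real ^ 'n"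
  assumes nonneg: "\<And>x. 0 \<le> I x" and x: "x \<in> microcanonical_macrostates I Ht u"
  shows "x \<in> canonical_macrostates I Ht \<beta> \<longleftrightarrow>
    (\<forall>w. microcanonical_entropy I Ht w
           \<le> microcanonical_entropy I Ht u + ereal (\<beta> \<bullet> (w - u)))"
proof -
  have u: "u \<in> entropy_dom I Ht" and Htx: "Ht x = u"
    and Ix: "I x = - microcanonical_entropy I Ht u"
    using x by (auto simp: microcanonical_macrostates_def split: if_splits)
  obtain m where m: "I x = ereal m" and s: "microcanonical_entropy I Ht u = ereal (- m)"
    using Ix u nonneg[of x]
    by (cases "microcanonical_entropy I Ht u") (auto simp: entropy_dom_def)
  have rearrange: "ereal m + ereal (\<beta> \<bullet> u) \<le> I y + ereal (\<beta> \<bullet> Ht y) \<longleftrightarrow>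
      - (ereal (- m) + ereal (\<beta> \<bullet> (Ht y - u))) \<le> I y" for y
    using nonneg[of y] by (cases "I y") (auto simp: inner_diff_right)
  show ?thesis
    unfolding canonical_macrostates_iff microcanonical_entropy_le_iff s m Htx rearrange
    by blast
qed

theorem theorem4p4:
  fixes P :: "nat \<Rightarrow> 'w measure"
    and a :: "nat \<Rightarrow> real"
    and H :: "nat \<Rightarrow> 'n::finite \<Rightarrow> 'w \<Rightarrow> real"
    and Y :: "nat \<Rightarrow> 'w \<Rightarrow> 'x::polish_space"
    and Ht :: "'x \<Rightarrow> real ^ 'n"
    and I :: "'x \<Rightarrow> ereal"
    and u :: "real ^ 'n"
  assumes "\<And>n. prob_space (P n)"
    and "\<And>n i. H n i \<in> borel_measurable (P n)"
    and "\<And>n i. bounded (H n i ` space (P n))"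
    and "\<And>n. a n > 0"
    and "filterlim a at_top sequentially"
    and "\<And>n. Y n \<in> measurable (P n) borel"
    and "\<And>i. continuous_on UNIV (\<lambda>x. Ht x $ i)"
    and "\<And>i. bounded (range (\<lambda>x. Ht x $ i))"
    and "\<And>i. (\<lambda>n. SUP \<omega>\<in>space (P n). \<bar>H n i \<omega> - Ht (Y n \<omega>) $ i\<bar>) \<longlonglongrightarrow> 0"
    and "large_deviation_principle P Y a I"
    and "u \<in> entropy_dom I Ht"
  shows "(u \<in> entropy_support_set I Ht \<longleftrightarrow>
            (\<exists>\<beta>. microcanonical_macrostates I Ht u \<subseteq> canonical_macrostates I Ht \<beta>)) \<and>
         (u \<notin> entropy_support_set I Ht \<longleftrightarrow>
            (\<forall>\<beta>. microcanonical_macrostates I Ht u \<inter> canonical_macrostates I Ht \<beta> = {}))"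
proof -
  let ?E = "microcanonical_macrostates I Ht u"
  have rate: "rate_function I"
    using assms(10) by (simp add: large_deviation_principle_def)
  then have nonneg: "0 \<le> I x" for x
    by (simp add: rate_function_def)
  have "continuous_on UNIV (\<lambda>x. \<chi> i. Ht x $ i)"
    using assms(7) by (rule continuous_on_vec_lambda)
  then have "continuous_on UNIV Ht"
    by simp
  then obtain x0 where x0: "x0 \<in> ?E"
    using microcanonical_macrostates_nonempty[OF rate _ assms(11)] by blast
  have supp: "u \<in> entropy_support_set I Ht \<longleftrightarrow> (\<exists>\<beta>. x \<in> canonical_macrostates I Ht \<beta>)"
    if "x \<in> ?E" for x
    unfolding entropy_support_set_def
    using microcanonical_macrostate_canonical_iff[OF nonneg that] by simp
  have all_or_none: "x \<in> canonical_macrostates I Ht \<beta> \<longleftrightarrow> y \<in> canonical_macrostates I Ht \<beta>"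
    if "x \<in> ?E" "y \<in> ?E" for x y \<beta>
    using that[THEN microcanonical_macrostate_canonical_iff[OF nonneg]] by simp
  show ?thesis
  proof (intro conjI)
    show "u \<in> entropy_support_set I Ht \<longleftrightarrow> (\<exists>\<beta>. ?E \<subseteq> canonical_macrostates I Ht \<beta>)"
      using x0 supp[OF x0] all_or_none[OF x0] by blast
    show "u \<notin> entropy_support_set I Ht \<longleftrightarrow> (\<forall>\<beta>. ?E \<inter> canonical_macrostates I Ht \<beta> = {})"
      using x0 supp by blast
  qed
qed

end
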